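(* Let $G$ be a group with neutral element $e$ and let $S=\bigoplus_{g\in G}S_g$ be a $G$-graded ring. Then $S$ is graded von Neumann regular if and only if $S$ is nearly epsilon-strongly $G$-graded and $S_e$ is von Neumann regular.
   Context: Rings are associative but not necessarily unital. A $G$-grading of a ring $S$ is a collection $\{S_g\}_{g\in G}$ of additive subgroups of $S$ with $S=\bigoplus_{g\in G}S_g$ and $S_gS_h\subseteq S_{gh}$ for all $g,h\in G$; $S_e$ is then a subring. For additive subgroups $A,B\subseteq S$, $AB$ denotes the set of finite sums of products $ab$ with $a\in A$, $b\in B$. A ring $R$ is von Neumann regular if for every $x\in R$ there is $y\in R$ with $x=xyx$. The $G$-graded ring $S$ is graded von Neumann regular if for every $g\in G$ and every $a\in S_g$ one has $a\in aSa$, where $aSa=\{asa\mid s\in S\}$. The $G$-graded ring $S$ is nearly epsilon-strongly $G$-graded if for every $g\in G$ and every $s\in S_g$ there are elements $\epsilon_g(s)\in S_gS_{g^{-1}}$ and $\epsilon_g'(s)\in S_{g^{-1}}S_g$ such that $\epsilon_g(s)s=s=s\epsilon_g'(s)$. *)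

theory Defs
  imports Main
begin

text \<open>
  The type class \<^class>\<open>ring\<close> is that of associative rings without any unit assumption.
  The grading group is a type of class \<^class>\<open>group_add\<close>, the class of (not necessarily abelian)
  groups; it is therefore written additively: \<open>g + h\<close>, \<open>0\<close> and \<open>- g\<close> stand for
  \<open>gh\<close>, the neutral element and the inverse of \<open>g\<close>.
\<close>

definition add_subgroup :: "'s::ab_group_add set \<Rightarrow> bool" where
  "add_subgroup A \<longleftrightarrow> 0 \<in> A \<and> (\<forall>x\<in>A. \<forall>y\<in>A. x + y \<in> A) \<and> (\<forall>x\<in>A. - x \<in> A)"

text \<open>The product \<open>AB\<close> consists of finite sums of products, unlike the elementwise product of sets.\<close>

definition sprod :: "'s::ring set \<Rightarrow> 's set \<Rightarrow> 's set"  (infixl "\<odot>" 70) where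
  "A \<odot> B = {\<Sum>i<n. a i * b i | (n::nat) a b. \<forall>i<n. a i \<in> A \<and> b i \<in> B}"

text \<open>The whole type is the internal direct sum of the family \<open>S\<close>.\<close>

definition is_direct_sum :: "('g \<Rightarrow> 's::ab_group_add set) \<Rightarrow> bool" where
  "is_direct_sum S \<longleftrightarrow>
     (\<forall>s. \<exists>!f. (\<forall>g. f g \<in> S g) \<and> finite {g. f g \<noteq> 0} \<and> s = (\<Sum>g | f g \<noteq> 0. f g))"

definition is_grading :: "('g::group_add \<Rightarrow> 's::ring set) \<Rightarrow> bool" where
  "is_grading S \<longleftrightarrow>
     (\<forall>g. add_subgroup (S g)) \<and> is_direct_sum S \<and> (\<forall>g h. S g \<odot> S h \<subseteq> S (g + h))"

text \<open>Von Neumann regularity of a subring, given by its carrier; the witness has to lie in the subring.\<close>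

definition von_neumann_regular :: "'s::ring set \<Rightarrow> bool" where
  "von_neumann_regular R \<longleftrightarrow> (\<forall>x\<in>R. \<exists>y\<in>R. x = x * y * x)"

definition graded_von_neumann_regular :: "('g \<Rightarrow> 's::ring set) \<Rightarrow> bool" where
  "graded_von_neumann_regular S \<longleftrightarrow> (\<forall>g. \<forall>a\<in>S g. a \<in> {a * s * a | s. True})"

definition nearly_epsilon_strongly_graded :: "('g::group_add \<Rightarrow> 's::ring set) \<Rightarrow> bool" where
  "nearly_epsilon_strongly_graded S \<longleftrightarrow>
     (\<forall>g. \<forall>s\<in>S g. \<exists>\<epsilon>\<in>S g \<odot> S (- g). \<exists>\<epsilon>'\<in>S (- g) \<odot> S g. \<epsilon> * s = s \<and> s = s * \<epsilon>')"

end

theory Submission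
  imports Defs
begin

text \<open>
  If \<open>a\<close> is homogeneous of degree \<open>g\<close> and \<open>a = a s a\<close>, comparing components of degree \<open>g\<close>
  shows that \<open>s\<close> may be replaced by its component of degree \<open>g\<^sup>-\<^sup>1\<close>; call it \<open>t\<close>. Then \<open>a t\<close> and
  \<open>t a\<close> are the required local units, and \<open>g = e\<close> gives the regularity of \<open>S\<^sub>e\<close>.

  Conversely, let \<open>s = (\<Sum>i. c\<^sub>i b\<^sub>i) s\<close> with \<open>c\<^sub>i \<in> S\<^sub>g\<close> and \<open>b\<^sub>i\<close> in the component of
  degree \<open>g\<^sup>-\<^sup>1\<close>. The elements \<open>b\<^sub>i s\<close> lie in the left ideal \<open>{t s}\<close> of \<open>S\<^sub>e\<close>, where \<open>t\<close> ranges over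
  the component of degree \<open>g\<^sup>-\<^sup>1\<close>. In a regular ring finitely many elements of a left ideal have
  a common right unit in that ideal, so some \<open>t s\<close> satisfies \<open>b\<^sub>i s t s = b\<^sub>i s\<close> for all \<open>i\<close>, and
  therefore \<open>s t s = s\<close>.
\<close>

lemma add_subgroup_diff:
  assumes "add_subgroup A" "x \<in> A" "y \<in> A"
  shows "x - y \<in> A"
proof -
  have "x + - y \<in> A" using assms unfolding add_subgroup_def by blast
  then show ?thesis by simp
qed

lemma mult_in_sprod:
  assumes "a \<in> A" "b \<in> B"
  shows "a * b \<in> A \<odot> B"
proof -
  have "a * b = (\<Sum>i<Suc 0. (\<lambda>_. a) i * (\<lambda>_. b) i)" by simp
  moreover have "\<forall>i<Suc 0. (\<lambda>_. a) i \<in> A \<and> (\<lambda>_. b) i \<in> B" using assms by simp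
  ultimately show ?thesis unfolding sprod_def mem_Collect_eq by (intro exI conjI)
qed

lemma grading_mult:
  assumes "is_grading S" "a \<in> S g" "b \<in> S h"
  shows "a * b \<in> S (g + h)"
  using assms mult_in_sprod unfolding is_grading_def by blast

text \<open>Both \<open>F\<close> and the family with value \<open>a\<close> at \<open>g\<close> and
  0 elsewhere decompose \<open>a\<close>, so uniqueness of the decomposition identifies
  them.\<close>

lemma direct_sum_component_eq:
  assumes ds: "is_direct_sum S" and zero: "\<And>k. 0 \<in> S k"
    and "finite A" and F: "\<And>k. F k \<in> S k" and out: "\<And>k. k \<notin> A \<Longrightarrow> F k = 0"
    and a: "a \<in> S g" "a = (\<Sum>k\<in>A. F k)"
  shows "a = F g"
proof -
  let ?P = "\<lambda>f. (\<forall>k. f k \<in> S k) \<and> finite {k. f k \<noteq> 0} \<and> a = (\<Sum>k | f k \<noteq> 0. f k)"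
  let ?D = "\<lambda>k. if k = g then a else 0"
  have sub: "{k. F k \<noteq> 0} \<subseteq> A" using out by blast
  have "(\<Sum>k | F k \<noteq> 0. F k) = (\<Sum>k\<in>A. F k)"
    using \<open>finite A\<close> sub by (intro sum.mono_neutral_left) auto
  moreover have "finite {k. F k \<noteq> 0}"
    using sub \<open>finite A\<close> by (rule finite_subset)
  ultimately have P1: "?P F" using F a by simp
  have "(\<Sum>k | ?D k \<noteq> 0. ?D k) = (\<Sum>k\<in>{g}. ?D k)"
    by (intro sum.mono_neutral_left) auto
  moreover have "finite {k. ?D k \<noteq> 0}"
    by (rule finite_subset[of _ "{g}"]) auto
  ultimately have P2: "?P ?D" using zero a(1) by simp
  have "\<exists>!f. ?P f" using ds unfolding is_direct_sum_def by blast
  then obtain f where "\<And>h. ?P h \<Longrightarrow> h = f" by (elim ex1E) blast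
  from this[OF P1] this[OF P2] have "F = ?D" by (rule trans[OF _ sym])
  from fun_cong[OF this, of g] show ?thesis by simp
qed

lemma graded_regular_homogeneous_witness:
  fixes S :: "'g::group_add \<Rightarrow> 's::ring set"
  assumes gr: "is_grading S" and a: "a \<in> S g" "a = a * s * a"
  obtains t where "t \<in> S (- g)" "a = a * t * a"
proof -
  have ds: "is_direct_sum S" and zero: "\<And>k. 0 \<in> S k"
    using gr unfolding is_grading_def add_subgroup_def by blast+
  obtain f where f: "\<And>k. f k \<in> S k" "finite {k. f k \<noteq> 0}" "s = (\<Sum>k | f k \<noteq> 0. f k)"
    using ds unfolding is_direct_sum_def by metis
  \<comment> \<open>The index \<open>- g + k - g\<close> is the solution \<open>h\<close> of
    \<open>g + h + g = k\<close>, so \<open>F k\<close> is the component of \<open>a * s * a\<close>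
    in degree \<open>k\<close>; the group need not be abelian.\<close>
  define F where "F k = a * f (- g + k - g) * a" for k
  define A where "A = (\<lambda>h. g + h + g) ` {h. f h \<noteq> 0}"
  have "F k \<in> S k" for k
  proof -
    have "F k \<in> S (g + (- g + k - g) + g)"
      unfolding F_def by (intro grading_mult[OF gr] a f)
    then show ?thesis by (simp add: algebra_simps)
  qed
  moreover have "F k = 0" if "k \<notin> A" for k
  proof -
    have "f (- g + k - g) = 0"
    proof (rule ccontr)
      assume "f (- g + k - g) \<noteq> 0"
      then have "g + (- g + k - g) + g \<in> A" unfolding A_def by blast
      then show False using that by (simp add: algebra_simps)
    qed
    then show ?thesis by (simp add: F_def)
  qed
  moreover have "a = (\<Sum>k\<in>A. F k)"
  proof -
    have "inj_on (\<lambda>h. g + h + g) {h. f h \<noteq> 0}" by (auto intro: inj_onI)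
    then have "(\<Sum>k\<in>A. F k) = (\<Sum>h | f h \<noteq> 0. F (g + h + g))"
      unfolding A_def by (simp add: sum.reindex)
    also have "\<dots> = (\<Sum>h | f h \<noteq> 0. a * f h * a)"
      by (simp add: F_def add.assoc flip: add_diff_eq)
    also have "\<dots> = a * s * a"
      unfolding f(3) by (simp add: sum_distrib_left sum_distrib_right)
    also note a(2)[symmetric]
    finally show ?thesis by (rule sym)
  qed
  moreover have "finite A" using f(2) unfolding A_def by simp
  ultimately have "a = F g"
    using direct_sum_component_eq[OF ds zero] a(1) by blast
  then have "a = a * f (- g) * a" by (simp add: F_def)
  then show thesis using that f(1) by blast
qed

text \<open>Induction on \<open>X\<close>: a right unit \<open>u\<close> for the earlier elements is
  corrected by a term that they annihilate and that repairs the defect \<open>x - x * u\<close> of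
  the new element.\<close>

lemma regular_left_ideal_common_right_unit:
  assumes reg: "von_neumann_regular R" and L: "add_subgroup L" "L \<subseteq> R"
    and ideal: "\<And>r x. r \<in> R \<Longrightarrow> x \<in> L \<Longrightarrow> r * x \<in> L"
    and "finite X" "X \<subseteq> L"
  shows "\<exists>u\<in>L. \<forall>x\<in>X. x * u = x"
  using \<open>finite X\<close> \<open>X \<subseteq> L\<close>
proof (induction X rule: finite_induct)
  case empty
  then show ?case using L unfolding add_subgroup_def by blast
next
  case (insert x X)
  then obtain u where u: "u \<in> L" "\<And>z. z \<in> X \<Longrightarrow> z * u = z" by auto
  have "x \<in> L" using insert.prems by simp
  define d where "d = x - x * u"
  have d: "d \<in> L"
    unfolding d_def using \<open>x \<in> L\<close> u(1) L ideal by (intro add_subgroup_diff) auto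
  then obtain y where y: "y \<in> R" "d = d * y * d"
    using reg L(2) unfolding von_neumann_regular_def by blast
  \<comment> \<open>Formally \<open>1 - v = (1 - u) (1 - y d)\<close>, although there need not be a unit.\<close>
  define v where "v = u + (y * d - u * (y * d))"
  have yd: "y * d \<in> L" using y(1) d ideal by blast
  have "v \<in> L"
  proof -
    have "y * d - u * (y * d) \<in> L"
      using yd u(1) L ideal by (intro add_subgroup_diff) auto
    then show ?thesis using u(1) L(1) unfolding v_def add_subgroup_def by blast
  qed
  moreover have "z * v = z" if "z \<in> X" for z
  proof -
    have "z * v = z * u + (z * (y * d) - (z * u) * (y * d))"
      by (simp add: v_def algebra_simps)
    then show ?thesis by (simp add: u(2)[OF that])
  qed
  moreover have "x * v = x"
  proof -
    \<comment> \<open>The correction contributes \<open>(x - x * u) * (y * d)\<close>, which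
      regularity turns back into \<open>d\<close>.\<close>
    have "x * v = x * u + d * y * d"
      unfolding v_def by (simp add: d_def algebra_simps)
    also have "\<dots> = x" unfolding y(2)[symmetric] by (simp add: d_def)
    finally show ?thesis .
  qed
  ultimately show ?case by blast
qed

lemma nearly_epsilon_regular_imp_graded_regular:
  fixes S :: "'g::group_add \<Rightarrow> 's::ring set"
  assumes gr: "is_grading S" and ne: "nearly_epsilon_strongly_graded S"
    and reg: "von_neumann_regular (S 0)"
  shows "graded_von_neumann_regular S"
  unfolding graded_von_neumann_regular_def
proof (intro allI ballI)
  fix g s assume s: "s \<in> S g"
  obtain e where e: "e \<in> S g \<odot> S (- g)" "e * s = s"
    using ne s unfolding nearly_epsilon_strongly_graded_def by blast
  then obtain n :: nat and c b where cb: "e = (\<Sum>i<n. c i * b i)"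
      "\<And>i. i < n \<Longrightarrow> c i \<in> S g \<and> b i \<in> S (- g)"
    unfolding sprod_def by blast
  define L where "L = (\<lambda>t. t * s) ` S (- g)"
  have sg: "add_subgroup (S (- g))" using gr unfolding is_grading_def by blast
  have L1: "add_subgroup L"
    unfolding add_subgroup_def
  proof (intro conjI ballI)
    show "0 \<in> L" using sg unfolding L_def add_subgroup_def
      by (metis image_eqI mult_zero_left)
  next
    fix x y assume "x \<in> L" "y \<in> L"
    then show "x + y \<in> L" using sg unfolding L_def add_subgroup_def
      by (auto simp flip: distrib_right)
  next
    fix x assume "x \<in> L"
    then show "- x \<in> L" using sg unfolding L_def add_subgroup_def
      by (auto simp flip: mult_minus_left)
  qed
  have L2: "L \<subseteq> S 0"
    using grading_mult[OF gr _ s, of _ "- g"] unfolding L_def by auto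
  have L3: "r * x \<in> L" if "r \<in> S 0" "x \<in> L" for r x
    using that grading_mult[OF gr that(1), of _ "- g"] unfolding L_def
    by (auto simp flip: mult.assoc)
  have "(\<lambda>i. b i * s) ` {..<n} \<subseteq> L" using cb(2) unfolding L_def by auto
  then obtain u where u: "u \<in> L" "\<And>i. i < n \<Longrightarrow> b i * s * u = b i * s"
    using regular_left_ideal_common_right_unit[OF reg L1 L2 L3, of "(\<lambda>i. b i * s) ` {..<n}"]
    by auto
  obtain t where t: "u = t * s" using u(1) unfolding L_def by blast
  \<comment> \<open>Inserting \<open>e\<close> before \<open>s\<close> exposes the factors
    \<open>b i * s\<close>, which \<open>u\<close> fixes on the right.\<close>
  have "s * t * s = e * s * u" using e(2) t by (simp add: mult.assoc)
  also have "\<dots> = (\<Sum>i<n. c i * (b i * s * u))"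
    by (simp add: cb(1) sum_distrib_right mult.assoc)
  also have "\<dots> = (\<Sum>i<n. c i * (b i * s))" using u(2) by simp
  also have "\<dots> = e * s" by (simp add: cb(1) sum_distrib_right mult.assoc)
  finally have "s = s * t * s" using e(2) by simp
  then show "s \<in> {s * r * s | r. True}" by blast
qed

theorem theorem1p2:
  fixes S :: "'g::group_add \<Rightarrow> 's::ring set"
  assumes "is_grading S"
  shows "graded_von_neumann_regular S \<longleftrightarrow>
           nearly_epsilon_strongly_graded S \<and> von_neumann_regular (S 0)"
proof
  assume "graded_von_neumann_regular S"
  then have wit: "\<exists>t\<in>S (- g). a = a * t * a" if "a \<in> S g" for a g
    using that graded_regular_homogeneous_witness[OF assms that]
    unfolding graded_von_neumann_regular_def by blast
  \<comment> \<open>In degree 0 the witness has degree \<open>- 0 = 0\<close>, hence lies in the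
    subring itself.\<close>
  have "von_neumann_regular (S 0)"
    unfolding von_neumann_regular_def using wit[of _ 0] unfolding minus_zero by blast
  moreover have "nearly_epsilon_strongly_graded S"
    unfolding nearly_epsilon_strongly_graded_def
  proof (intro allI ballI)
    fix g a assume a: "a \<in> S g"
    then obtain t where t: "t \<in> S (- g)" "a = a * t * a" using wit by blast
    show "\<exists>\<epsilon>\<in>S g \<odot> S (- g). \<exists>\<epsilon>'\<in>S (- g) \<odot> S g. \<epsilon> * a = a \<and> a = a * \<epsilon>'"
    proof (intro bexI conjI)
      show "a * t * a = a" by (rule t(2)[symmetric])
      show "a = a * (t * a)" unfolding mult.assoc[symmetric] by (rule t(2))
    qed (use a t(1) mult_in_sprod in blast)+
  qed
  ultimately show "nearly_epsilon_strongly_graded S \<and> von_neumann_regular (S 0)" by blast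
next
  assume "nearly_epsilon_strongly_graded S \<and> von_neumann_regular (S 0)"
  then show "graded_von_neumann_regular S"
    using nearly_epsilon_regular_imp_graded_regular[OF assms] by blast
qed

end
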